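(* Let $n\ge1$ and let $\alpha_1,\dots,\alpha_n,\beta_1,\dots,\beta_n,\gamma\in\widehat{\kappa^\times}$. Suppose that $\alpha_i\neq\varepsilon$ for all $i$ and $\beta_1\cdots\beta_n\neq\gamma$. Then, for all $\lambda_1,\dots,\lambda_n\in\kappa^\times$, $$(-1)^n\frac{\Big(\prod_{i=1}^n g(\beta_i)\Big)g(\overline{\beta_1\cdots\beta_n}\gamma)}{g^\circ(\gamma)}\,F_B^{(n)}\left({\alpha_1,\dots,\alpha_n;\beta_1,\dots,\beta_n\atop\gamma};\lambda_1,\dots,\lambda_n\right)$$ $$=\sum_{u_1,\dots,u_n\in\kappa^\times}\Big(\prod_{i=1}^n\overline{\alpha_i}(1-\lambda_iu_i)\Big)\Big(\prod_{i=1}^n\beta_i(u_i)\Big)\overline{\beta_1\cdots\beta_n}\gamma\Big(1-\sum_{i=1}^nu_i\Big).$$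
   Context: $\kappa$ is a finite field with $q$ elements of characteristic $p$. $\widehat{\kappa^\times}=\mathrm{Hom}(\kappa^\times,\overline{\mathbb{Q}}^\times)$ is the group of multiplicative characters, $\varepsilon$ the trivial character, $\overline{\eta}=\eta^{-1}$; every $\eta\in\widehat{\kappa^\times}$ (including $\varepsilon$) is extended to $\kappa$ by $\eta(0)=0$. A product of characters followed by an argument means the product character evaluated there. $\delta(\eta)=1$ if $\eta=\varepsilon$ and $0$ otherwise. Fix a non-trivial additive character $\psi\in\mathrm{Hom}(\kappa,\overline{\mathbb{Q}}^\times)$. Put $$g(\eta)=-\sum_{x\in\kappa^\times}\psi(x)\eta(x),\quad g^\circ(\eta)=q^{\delta(\eta)}g(\eta),\quad(\alpha)_\nu=\frac{g(\alpha\nu)}{g(\alpha)},\quad(\alpha)_\nu^\circ=\frac{g^\circ(\alpha\nu)}{g^\circ(\alpha)}.$$ For $\lambda_i\in\kappa$, $$F_B^{(n)}\left({\alpha_1,\dots,\alpha_n;\beta_1,\dots,\beta_n\atop\gamma};\lambda_1,\dots,\lambda_n\right)=\frac{1}{(1-q)^n}\sum_{\nu_1,\dots,\nu_n\in\widehat{\kappa^\times}}\frac{(\alpha_1)_{\nu_1}\cdots(\alpha_n)_{\nu_n}(\beta_1)_{\nu_1}\cdots(\beta_n)_{\nu_n}}{(\gamma)^\circ_{\nu_1\cdots\nu_n}(\varepsilon)^\circ_{\nu_1}\cdots(\varepsilon)^\circ_{\nu_n}}\nu_1(\lambda_1)\cdots\nu_n(\lambda_n).$$ *)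

theory Defs
  imports "HOL-Algebra.Algebraic_Closure_Type" "HOL-Library.FuncSet" "HOL-Library.Cardinality"
begin

type_synonym qbar = "rat alg_closure"

text \<open>
  A multiplicative character is represented by its extension by zero to the whole field, so
  that products and inverses of characters have to be extensions by zero as well.
\<close>

definition mult_chars :: "('k::{field,finite} \<Rightarrow> qbar) set" where
  "mult_chars = {\<eta>. \<eta> 0 = 0 \<and> (\<forall>x. x \<noteq> 0 \<longrightarrow> \<eta> x \<noteq> 0) \<and>
     (\<forall>x y. x \<noteq> 0 \<longrightarrow> y \<noteq> 0 \<longrightarrow> \<eta> (x * y) = \<eta> x * \<eta> y)}"

definition triv_char :: "'k::{field,finite} \<Rightarrow> qbar" where
  "triv_char x = (if x = 0 then 0 else 1)"

definition char_mult :: "('k::{field,finite} \<Rightarrow> qbar) \<Rightarrow> ('k \<Rightarrow> qbar) \<Rightarrow> 'k \<Rightarrow> qbar" where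
  "char_mult \<alpha> \<beta> x = \<alpha> x * \<beta> x"

text \<open>At \<open>0\<close> this is the right inverse, since \<open>inverse 0 = 0\<close>.\<close>

definition char_inv :: "('k::{field,finite} \<Rightarrow> qbar) \<Rightarrow> 'k \<Rightarrow> qbar" where
  "char_inv \<eta> x = inverse (\<eta> x)"

text \<open>The value at \<open>0\<close> is prescribed so that the empty product is the trivial character.\<close>

definition char_prod :: "'i set \<Rightarrow> ('i \<Rightarrow> 'k::{field,finite} \<Rightarrow> qbar) \<Rightarrow> 'k \<Rightarrow> qbar" where
  "char_prod I \<beta> x = (if x = 0 then 0 else (\<Prod>i\<in>I. \<beta> i x))"

definition add_chars :: "('k::{field,finite} \<Rightarrow> qbar) set" where
  "add_chars = {\<psi>. (\<forall>x. \<psi> x \<noteq> 0) \<and> (\<forall>x y. \<psi> (x + y) = \<psi> x * \<psi> y)}"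

definition gauss_sum :: "('k::{field,finite} \<Rightarrow> qbar) \<Rightarrow> ('k \<Rightarrow> qbar) \<Rightarrow> qbar" where
  "gauss_sum \<psi> \<eta> = - (\<Sum>x\<in>UNIV - {0}. \<psi> x * \<eta> x)"

definition char_delta :: "('k::{field,finite} \<Rightarrow> qbar) \<Rightarrow> nat" where
  "char_delta \<eta> = (if \<eta> = triv_char then 1 else 0)"

definition gauss_sum_circ :: "('k::{field,finite} \<Rightarrow> qbar) \<Rightarrow> ('k \<Rightarrow> qbar) \<Rightarrow> qbar" where
  "gauss_sum_circ \<psi> \<eta> = of_nat CARD('k) ^ char_delta \<eta> * gauss_sum \<psi> \<eta>"

definition poch :: "('k::{field,finite} \<Rightarrow> qbar) \<Rightarrow> ('k \<Rightarrow> qbar) \<Rightarrow> ('k \<Rightarrow> qbar) \<Rightarrow> qbar" where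
  "poch \<psi> \<alpha> \<nu> = gauss_sum \<psi> (char_mult \<alpha> \<nu>) / gauss_sum \<psi> \<alpha>"

definition poch_circ :: "('k::{field,finite} \<Rightarrow> qbar) \<Rightarrow> ('k \<Rightarrow> qbar) \<Rightarrow> ('k \<Rightarrow> qbar) \<Rightarrow> qbar" where
  "poch_circ \<psi> \<alpha> \<nu> = gauss_sum_circ \<psi> (char_mult \<alpha> \<nu>) / gauss_sum_circ \<psi> \<alpha>"

definition lauricella_FB ::
  "('k::{field,finite} \<Rightarrow> qbar) \<Rightarrow> nat \<Rightarrow> (nat \<Rightarrow> 'k \<Rightarrow> qbar) \<Rightarrow> (nat \<Rightarrow> 'k \<Rightarrow> qbar) \<Rightarrow>
     ('k \<Rightarrow> qbar) \<Rightarrow> (nat \<Rightarrow> 'k) \<Rightarrow> qbar" where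
  "lauricella_FB \<psi> n \<alpha> \<beta> \<gamma> x =
     1 / (1 - of_nat CARD('k)) ^ n *
     (\<Sum>\<nu>\<in>PiE {1..n} (\<lambda>_. mult_chars).
        (\<Prod>i=1..n. poch \<psi> (\<alpha> i) (\<nu> i)) * (\<Prod>i=1..n. poch \<psi> (\<beta> i) (\<nu> i)) /
        (poch_circ \<psi> \<gamma> (char_prod {1..n} \<nu>) * (\<Prod>i=1..n. poch_circ \<psi> triv_char (\<nu> i))) *
        (\<Prod>i=1..n. \<nu> i (x i)))"

end

theory Submission
  imports Defs
begin

text \<open>The proof mirrors the classical derivation of the integral representation of Lauricella's function:
Gauss sums play the role of the Gamma function, the Jacobi sum that of the Dirichlet integral, and
the one-variable binomial series is summed under the integral sign.

Put \<open>c = \<gamma> / (\<beta>\<^sub>1 \<cdots> \<beta>\<^sub>n)\<close>, which is nontrivial by assumption. The reflection formula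
\<open>gauss_sum_reflection\<close> turns every denominator \<open>poch_circ \<psi> triv_char (\<nu> i)\<close> of the series into a Gauss
sum of the inverse of \<open>\<nu> i\<close> in the numerator. Together with the prefactor, what is left of
the \<open>\<beta>\<close>- and \<open>\<gamma>\<close>-factors is a quotient of Gauss sums that \<open>jacobi_sum_eq_gauss_sums\<close> identifies with
the sum over \<open>u\<close> of \<open>(\<Prod>i. (\<beta>\<^sub>i \<nu>\<^sub>i) (u\<^sub>i)) * c (1 - (\<Sum>i. u\<^sub>i))\<close>. After the sums over \<open>\<nu>\<close> and \<open>u\<close> are exchanged,
the sum over \<open>\<nu>\<close> is a product of sums over single characters, and \<open>binomial_theorem_gauss_sums\<close> evaluates
the \<open>i\<close>-th one, divided by the Gauss sum of \<open>\<alpha> i\<close>, to \<open>1 - q\<close> times the inverse of \<open>\<alpha> i\<close> at \<open>1 - x i * u i\<close>; this is where \<open>\<alpha> i\<close> must be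
nontrivial. The powers of \<open>1 - q\<close> cancel.

The binomial theorem rests on \<open>sum_over_mult_chars\<close>, the orthogonality relation for sums over all
characters. It holds because the multiplicative group of a finite field is cyclic of order
\<open>q - 1\<close> and \<open>X ^ (q - 1) - 1\<close> has \<open>q - 1\<close> different roots in the algebraic closure of the rationals.\<close>

section \<open>Roots of unity\<close>

text \<open>The polynomial \<open>X ^ N - 1\<close> splits into linear factors, and its derivative \<open>N X ^ (N - 1)\<close> vanishes
only at \<open>0\<close>, which is not a root. So its roots are simple and there are \<open>N\<close> of them.\<close>

lemma card_roots_of_unity:
  assumes "N > 0"
  shows "card {w :: 'a :: {alg_closed_field, field_char_0}. w ^ N = 1} = N"
proof -
  define p :: "'a poly" where "p = monom 1 N - 1"
  have lead: "coeff p N = 1" using assms by (simp add: p_def)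
  have "degree p \<le> N" unfolding p_def by (intro degree_diff_le) (auto simp: degree_monom_le)
  hence deg: "degree p = N" using lead le_degree[of p N] by simp
  have p0: "p \<noteq> 0" using lead by auto
  have root: "poly p w = 0 \<longleftrightarrow> w ^ N = 1" for w by (simp add: p_def poly_monom)
  have "poly (pderiv p) w \<noteq> 0" if "poly p w = 0" for w
  proof -
    have "w \<noteq> 0" using that assms by (auto simp: root power_0_left)
    moreover have "pderiv p = monom (of_nat N) (N - 1)"
      by (simp add: p_def pderiv_diff pderiv_monom)
    ultimately show ?thesis using assms by (simp add: poly_monom)
  qed
  hence sf: "rsquarefree p" by (auto simp: rsquarefree_roots)
  obtain A where A: "size A = degree p" "p = smult (lead_coeff p) (\<Prod>x\<in>#A. [:-x, 1:])"
    using alg_closed_imp_factorization[OF p0] by blast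
  have "proots (\<Prod>x\<in>#A. [:-x, 1:]) = A"
  proof (induction A)
    case (add x A)
    have "(\<Prod>x\<in>#A. [:-x, 1:]) \<noteq> 0" by (auto simp: prod_mset_zero_iff)
    thus ?case by (simp add: proots_mult add del: mult_pCons_left)
  qed simp
  hence "A = proots p"
    using A(2) p0 proots_smult[of "lead_coeff p" "\<Prod>x\<in>#A. [:-x, 1:]"] by simp
  have sA: "set_mset A = {w. w ^ N = 1}"
    using p0 by (simp add: \<open>A = proots p\<close> root)
  have "count A w = 1" if "w \<in># A" for w
    using sf that p0 by (simp add: \<open>A = proots p\<close> rsquarefree_root_order)
  hence "size A = card (set_mset A)"
    by (simp add: size_multiset_overloaded_eq)
  thus ?thesis using A(1) deg sA by simp
qed

text \<open>If \<open>N\<close> does not divide \<open>k\<close>, then some \<open>N\<close>-th root of unity \<open>v\<close> has \<open>v ^ k \<noteq> 1\<close>, and multiplication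
by \<open>v\<close> permutes the roots, so the sum equals \<open>v ^ k\<close> times itself. Such a \<open>v\<close> exists by counting:
only the remainder \<open>r\<close> of \<open>k\<close> modulo \<open>N\<close> matters, and only \<open>r < N\<close> numbers satisfy \<open>w ^ r = 1\<close>.\<close>

lemma sum_roots_of_unity_power:
  assumes "N > 0"
  shows "(\<Sum>w | w ^ N = (1 :: 'a :: {alg_closed_field, field_char_0}). w ^ k) =
           (if N dvd k then of_nat N else 0)"
proof (cases "N dvd k")
  case True
  hence "w ^ k = 1" if "w ^ N = 1" for w :: 'a
    using that by (auto simp: power_mult elim!: dvdE)
  thus ?thesis using True card_roots_of_unity[OF assms, where 'a = 'a] by simp
next
  case False
  define W where "W = {w :: 'a. w ^ N = 1}"
  define r where "r = k mod N"
  have r: "0 < r" "r < N" using False assms by (auto simp: r_def mod_greater_zero_iff_not_dvd)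
  have kr: "w ^ k = w ^ r" if "w \<in> W" for w
  proof -
    have "w ^ k = w ^ (N * (k div N) + r)" by (simp add: r_def)
    thus ?thesis using that by (simp only: power_add power_mult) (simp add: W_def)
  qed
  have "finite W" using card_roots_of_unity[OF assms, where 'a = 'a] assms card.infinite[of W]
    by (auto simp: W_def)
  have "\<exists>v\<in>W. v ^ r \<noteq> 1"
  proof (rule ccontr)
    assume "\<not> ?thesis"
    hence "W \<subseteq> {w. w ^ r = 1}" by auto
    moreover have "finite {w :: 'a. w ^ r = 1}"
      using card_roots_of_unity[OF r(1), where 'a = 'a] r(1) card.infinite by fastforce
    ultimately have "card W \<le> r"
      using card_roots_of_unity[OF r(1), where 'a = 'a] by (metis card_mono)
    thus False using r(2) card_roots_of_unity[OF assms, where 'a = 'a] by (simp add: W_def)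
  qed
  then obtain v where v: "v \<in> W" "v ^ r \<noteq> 1" by blast
  have v0: "v \<noteq> 0" using v(1) assms by (auto simp: W_def power_0_left)
  have "bij_betw ((*) v) W W"
    by (rule bij_betw_byWitness[where f' = "\<lambda>w. w / v"])
       (use v(1) v0 in \<open>auto simp: W_def power_mult_distrib power_divide\<close>)
  hence "(\<Sum>w\<in>W. w ^ k) = (\<Sum>w\<in>W. (v * w) ^ k)"
    by (rule sum.reindex_bij_betw[symmetric])
  also have "\<dots> = v ^ k * (\<Sum>w\<in>W. w ^ k)"
    by (simp add: power_mult_distrib sum_distrib_left)
  finally have "(\<Sum>w\<in>W. w ^ k) = 0" using v kr[OF v(1)] by simp
  thus ?thesis using False by (simp add: W_def)
qed

section \<open>Multiplicative characters and their orthogonality\<close>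

text \<open>Transports the cyclicity of the multiplicative group from record-based finite fields to the type class,
in a form that provides discrete logarithms.\<close>

lemma finite_field_generator:
  obtains g :: "'k::{field,finite}"
  where "g ^ (CARD('k) - 1) = 1" "bij_betw ((^) g) {..<CARD('k) - 1} (UNIV - {0})"
proof -
  define R :: "'k ring" where "R = ring_of_type_algebra"
  define N where "N = CARD('k) - 1"
  have "field R" unfolding R_def by (rule field_from_type_algebra)
  interpret R: field R by fact
  interpret M: group "Multiplicative_Group.mult_of R" by (rule R.field_mult_group)
  have carr: "carrier (Multiplicative_Group.mult_of R) = UNIV - {0}" and one: "\<one>\<^bsub>R\<^esub> = 1"
    by (simp_all add: R_def ring_of_type_algebra_def)
  have pow: "a [^]\<^bsub>Multiplicative_Group.mult_of R\<^esub> i = a ^ i" for a and i :: nat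
    by (simp add: Multiplicative_Group.nat_pow_mult_of, induction i)
       (auto simp: R_def ring_of_type_algebra_def nat_pow_def)
  have ordN: "Coset.order (Multiplicative_Group.mult_of R) = N"
    unfolding Coset.order_def carr by (simp add: N_def)
  have fin: "finite (carrier R)" by simp
  obtain g where g: "g \<in> carrier (Multiplicative_Group.mult_of R)"
    "carrier (Multiplicative_Group.mult_of R) = {g [^]\<^bsub>R\<^esub> i | i::nat. i \<in> UNIV}"
    using R.finite_field_mult_group_has_gen[OF fin] by blast
  have all: "UNIV - {0} = range ((^) g)"
    using g(2) pow[of g] unfolding carr Multiplicative_Group.nat_pow_mult_of by auto
  have gN: "g ^ N = 1"
    using M.pow_order_eq_1[OF g(1)] by (simp add: ordN one pow)
  have "0 < N"
    using finite_UNIV_card_ge_0 card_mono[of "UNIV :: 'k set" "{0,1}"] by (simp add: N_def)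
  have "range ((^) g) \<subseteq> (^) g ` {..<N}"
  proof safe
    fix i :: nat
    have "g ^ i = g ^ (N * (i div N) + i mod N)" by simp
    also have "\<dots> = g ^ (i mod N)" by (simp only: power_add power_mult gN) simp
    finally show "g ^ i \<in> (^) g ` {..<N}" using \<open>0 < N\<close> by auto
  qed
  hence img: "(^) g ` {..<N} = UNIV - {0}" using all by auto
  moreover have "inj_on ((^) g) {..<N}"
    by (rule eq_card_imp_inj_on) (simp_all add: img, simp add: N_def)
  ultimately show ?thesis
    using that[of g] gN by (simp add: N_def bij_betw_def)
qed

lemma mult_chars_0: "\<eta> \<in> mult_chars \<Longrightarrow> \<eta> 0 = 0"
  and mult_chars_nonzero: "\<eta> \<in> mult_chars \<Longrightarrow> x \<noteq> 0 \<Longrightarrow> \<eta> x \<noteq> 0"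
  by (auto simp: mult_chars_def)

lemma mult_chars_mult: "\<eta> \<in> mult_chars \<Longrightarrow> \<eta> (x * y) = \<eta> x * \<eta> y"
  by (cases "x = 0 \<or> y = 0") (auto simp: mult_chars_def)

lemma mult_chars_1: "\<eta> \<in> mult_chars \<Longrightarrow> \<eta> 1 = 1"
  using mult_chars_mult[of \<eta> 1 1] mult_chars_nonzero[of \<eta> 1] by simp

lemma mult_chars_inverse: "\<eta> \<in> mult_chars \<Longrightarrow> \<eta> (inverse x) = inverse (\<eta> x)"
  using mult_chars_mult[of \<eta> x "inverse x"] mult_chars_1[of \<eta>] mult_chars_0[of \<eta>]
  by (cases "x = 0") (auto simp: field_simps mult_chars_nonzero)

lemma mult_chars_power: "\<eta> \<in> mult_chars \<Longrightarrow> \<eta> (x ^ i) = \<eta> x ^ i"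
  by (induction i) (auto simp: mult_chars_1 mult_chars_mult)

lemma triv_char_in_mult_chars [simp]: "triv_char \<in> mult_chars"
  by (auto simp: mult_chars_def triv_char_def)

lemma char_mult_in_mult_chars [simp]:
  "\<eta> \<in> mult_chars \<Longrightarrow> \<chi> \<in> mult_chars \<Longrightarrow> char_mult \<eta> \<chi> \<in> mult_chars"
  by (auto simp: mult_chars_def char_mult_def)

lemma char_inv_in_mult_chars [simp]: "\<eta> \<in> mult_chars \<Longrightarrow> char_inv \<eta> \<in> mult_chars"
  by (auto simp: mult_chars_def char_inv_def)

lemma char_prod_in_mult_chars [simp]:
  assumes "finite I" "\<And>i. i \<in> I \<Longrightarrow> \<beta> i \<in> mult_chars"
  shows "char_prod I \<beta> \<in> mult_chars"
  using assms by (auto simp: mult_chars_def char_prod_def prod.distrib)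

lemma char_mult_triv [simp]: "\<eta> \<in> mult_chars \<Longrightarrow> char_mult triv_char \<eta> = \<eta>"
  by (auto simp: char_mult_def triv_char_def mult_chars_0)

lemma mult_chars_neq_trivE:
  assumes "\<eta> \<in> mult_chars" "\<eta> \<noteq> triv_char"
  obtains a where "a \<noteq> 0" "\<eta> a \<noteq> 1"
  using assms by (auto simp: fun_eq_iff triv_char_def mult_chars_0 split: if_splits)

lemma sum_nonzero_scale:
  fixes f :: "'k::{field,finite} \<Rightarrow> 'b::comm_monoid_add"
  assumes "a \<noteq> 0"
  shows "(\<Sum>x\<in>UNIV - {0}. f (a * x)) = (\<Sum>x\<in>UNIV - {0}. f x)"
  by (rule sum.reindex_bij_witness[where i = "\<lambda>x. x / a" and j = "\<lambda>x. a * x"])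
     (use assms in auto)

lemma sum_nontrivial_mult_char:
  assumes "\<eta> \<in> mult_chars" "\<eta> \<noteq> triv_char"
  shows "(\<Sum>x\<in>UNIV - {0}. \<eta> x) = 0"
proof -
  obtain a where a: "a \<noteq> 0" "\<eta> a \<noteq> 1" using mult_chars_neq_trivE[OF assms] .
  have "\<eta> a * (\<Sum>x\<in>UNIV - {0}. \<eta> x) = (\<Sum>x\<in>UNIV - {0}. \<eta> x)"
    using sum_nonzero_scale[OF a(1), of \<eta>]
    by (simp add: mult_chars_mult[OF assms(1)] sum_distrib_left)
  thus ?thesis using a(2) by simp
qed

text \<open>A character of a cyclic group is determined by its value at a generator \<open>g\<close>, and this value can be
any \<open>(q - 1)\<close>-st root of unity \<open>w\<close>: the character is then \<open>g ^ i \<mapsto> w ^ i\<close>.\<close>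

lemma bij_betw_mult_chars_roots_of_unity:
  fixes g :: "'k::{field,finite}"
  assumes g: "g ^ (CARD('k) - 1) = 1" "bij_betw ((^) g) {..<CARD('k) - 1} (UNIV - {0})"
  shows "bij_betw (\<lambda>\<eta>. \<eta> g) mult_chars {w. w ^ (CARD('k) - 1) = 1}"
proof -
  define N where "N = CARD('k) - 1"
  define dlog where "dlog = inv_into {..<N} ((^) g)"
  define chr where "chr = (\<lambda>w x. if x = 0 then 0 else w ^ dlog x :: qbar)"
  have inj: "inj_on ((^) g) {..<N}" and img: "(^) g ` {..<N} = UNIV - {0}"
    using g(2) by (auto simp: bij_betw_def N_def)
  have dlog: "dlog x < N" "g ^ dlog x = x" if "x \<noteq> 0" for x
    using that img inv_into_into[of x "(^) g" "{..<N}"] f_inv_into_f[of x "(^) g" "{..<N}"]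
    by (auto simp: dlog_def)
  have pow_mod: "w ^ (i mod N) = w ^ i" if "w ^ N = 1" for w :: "'b::monoid_mult" and i
  proof -
    have "w ^ i = w ^ (N * (i div N) + i mod N)" by simp
    also have "\<dots> = w ^ (i mod N)" by (simp only: power_add power_mult that) simp
    finally show ?thesis by simp
  qed
  have gN: "g ^ N = 1" using g(1) by (simp add: N_def)
  have "N > 0" using dlog(1)[of 1] by simp
  have dlog_pow: "dlog (g ^ i) = i mod N" for i
    using inv_into_f_f[OF inj, of "i mod N"] \<open>N > 0\<close> pow_mod[OF gN, of i]
    by (simp add: dlog_def)
  have g0: "g \<noteq> 0" using gN \<open>N > 0\<close> by (auto simp: power_0_left)
  have dlog_mult: "dlog (x * y) = (dlog x + dlog y) mod N" if "x \<noteq> 0" "y \<noteq> 0" for x y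
    using dlog_pow[of "dlog x + dlog y"] that by (simp add: power_add dlog)
  show ?thesis unfolding N_def[symmetric]
  proof (rule bij_betw_byWitness[where f' = chr])
    show "\<forall>\<eta>\<in>mult_chars. chr (\<eta> g) = \<eta>"
      using dlog(2) by (auto simp: chr_def fun_eq_iff mult_chars_0 simp flip: mult_chars_power)
    show "\<forall>w\<in>{w. w ^ N = 1}. chr w g = w"
      using g0 dlog_pow[of 1] pow_mod[of _ 1] by (auto simp: chr_def)
    show "(\<lambda>\<eta>. \<eta> g) ` mult_chars \<subseteq> {w. w ^ N = 1}"
      by (auto simp: gN mult_chars_1 simp flip: mult_chars_power)
    show "chr ` {w. w ^ N = 1} \<subseteq> mult_chars"
      using \<open>N > 0\<close>
      by (auto simp: chr_def mult_chars_def dlog_mult pow_mod power_add power_0_left)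
  qed
qed

text \<open>Orthogonality in the dual variable. Writing \<open>a = g ^ k\<close> with a generator \<open>g\<close> turns the sum over all
characters into the sum of the \<open>k\<close>-th powers of the roots of unity.\<close>

lemma finite_mult_chars: "finite (mult_chars :: ('k::{field,finite} \<Rightarrow> qbar) set)"
  and sum_over_mult_chars:
    "a \<noteq> 0 \<Longrightarrow> (\<Sum>\<nu>\<in>mult_chars. \<nu> (a :: 'k)) = (if a = 1 then of_nat CARD('k) - 1 else 0)"
proof -
  define N where "N = CARD('k) - 1"
  obtain g :: 'k where g: "g ^ N = 1" "bij_betw ((^) g) {..<N} (UNIV - {0})"
    using finite_field_generator N_def by metis
  note bij = bij_betw_mult_chars_roots_of_unity[OF g[unfolded N_def], folded N_def]
  have "1 \<in> (^) g ` {..<N}" using g(2) by (auto simp: bij_betw_def)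
  hence N: "N > 0" by auto
  have "finite {w :: qbar. w ^ N = 1}"
    using card_roots_of_unity[OF N, where 'a = qbar] N card.infinite by fastforce
  thus "finite (mult_chars :: ('k \<Rightarrow> qbar) set)"
    using bij_betw_finite[OF bij] by blast
  assume "a \<noteq> 0"
  then obtain k where k: "k < N" "a = g ^ k"
    using g(2) by (auto simp: bij_betw_def image_iff set_eq_iff)
  have "N dvd k \<longleftrightarrow> a = 1"
  proof
    assume "N dvd k"
    hence "k = 0" using k(1) by (auto dest: dvd_imp_le)
    thus "a = 1" using k(2) by simp
  next
    assume "a = 1"
    hence "g ^ k = g ^ 0" using k(2) by simp
    hence "k = 0"
      using inj_onD[of "(^) g" "{..<N}" k 0] g(2) k(1) N by (simp add: bij_betw_def)
    thus "N dvd k" by simp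
  qed
  moreover have "(\<Sum>\<nu>\<in>mult_chars. \<nu> a) = (\<Sum>\<nu>\<in>mult_chars. \<nu> g ^ k)"
    by (simp add: k(2) mult_chars_power)
  moreover have "\<dots> = (\<Sum>w | w ^ N = 1. w ^ k)"
    by (rule sum.reindex_bij_betw[OF bij])
  moreover have "of_nat N = (of_nat CARD('k) - 1 :: qbar)"
    using N by (simp add: N_def of_nat_diff)
  ultimately show "(\<Sum>\<nu>\<in>mult_chars. \<nu> a) = (if a = 1 then of_nat CARD('k) - 1 else 0)"
    by (simp add: sum_roots_of_unity_power[OF N])
qed

section \<open>Additive characters and Gauss sums\<close>

lemma add_chars_add: "\<psi> \<in> add_chars \<Longrightarrow> \<psi> (x + y) = \<psi> x * \<psi> y"
  by (auto simp: add_chars_def)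

lemma add_chars_0: "\<psi> \<in> add_chars \<Longrightarrow> \<psi> 0 = 1"
  using add_chars_add[of \<psi> 0 0] by (auto simp: add_chars_def)

lemma add_chars_sum: "\<psi> \<in> add_chars \<Longrightarrow> \<psi> (\<Sum>i\<in>I. f i) = (\<Prod>i\<in>I. \<psi> (f i))"
  by (induction I rule: infinite_finite_induct) (auto simp: add_chars_0 add_chars_add)

lemma sum_translate:
  fixes f :: "'k::{ab_group_add,finite} \<Rightarrow> 'b::comm_monoid_add"
  shows "(\<Sum>t\<in>UNIV. f (t + s)) = (\<Sum>t\<in>UNIV. f t)"
  by (rule sum.reindex_bij_witness[where i = "\<lambda>t. t - s" and j = "\<lambda>t. t + s"]) auto

lemma sum_nontrivial_add_char:
  assumes "\<psi> \<in> add_chars" "\<exists>a. \<psi> a \<noteq> 1"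
  shows "(\<Sum>x\<in>UNIV. \<psi> x) = 0"
proof -
  obtain a where a: "\<psi> a \<noteq> 1" using assms(2) by blast
  have "\<psi> a * (\<Sum>x\<in>UNIV. \<psi> x) = (\<Sum>x\<in>UNIV. \<psi> x)"
    using sum_translate[of \<psi> a]
    by (simp add: add_chars_add[OF assms(1)] sum_distrib_left mult.commute)
  thus ?thesis using a by simp
qed

lemma sum_nontrivial_add_char_nonzero:
  fixes \<psi> :: "'k::{field,finite} \<Rightarrow> qbar"
  assumes "\<psi> \<in> add_chars" "\<exists>a. \<psi> a \<noteq> 1"
  shows "(\<Sum>x\<in>UNIV - {0}. \<psi> (b * x)) = (if b = 0 then of_nat CARD('k) else 0) - 1"
proof (cases "b = 0")
  case True
  thus ?thesis by (simp add: add_chars_0[OF assms(1)] of_nat_diff)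
next
  case False
  have "(\<Sum>x\<in>UNIV - {0}. \<psi> x) = (\<Sum>x\<in>UNIV. \<psi> x) - \<psi> 0"
    by (simp add: sum_diff1)
  thus ?thesis using False
    by (simp add: sum_nonzero_scale[of b \<psi>] sum_nontrivial_add_char[OF assms] add_chars_0[OF assms(1)])
qed

lemma gauss_sum_triv_char:
  assumes "\<psi> \<in> add_chars" "\<exists>a. \<psi> a \<noteq> 1"
  shows "gauss_sum \<psi> triv_char = 1"
proof -
  have "gauss_sum \<psi> triv_char = - (\<Sum>x\<in>UNIV - {0}. \<psi> (1 * x))"
    by (auto simp: gauss_sum_def triv_char_def intro!: sum.cong)
  thus ?thesis by (subst (asm) sum_nontrivial_add_char_nonzero[OF assms]) simp
qed

text \<open>Substituting \<open>x / a\<close> for \<open>x\<close> restores \<open>\<psi> x\<close> and pulls a constant out of \<open>\<eta>\<close>.\<close>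

lemma gauss_sum_twist:
  assumes "\<eta> \<in> mult_chars" "a \<noteq> 0"
  shows "(\<Sum>x\<in>UNIV - {0}. \<psi> (a * x) * \<eta> x) = - char_inv \<eta> a * gauss_sum \<psi> \<eta>"
proof -
  have "(\<Sum>x\<in>UNIV - {0}. \<psi> (a * x) * \<eta> x) =
          (\<Sum>x\<in>UNIV - {0}. \<psi> (a * x) * (inverse (\<eta> a) * \<eta> (a * x)))"
    by (simp add: mult_chars_mult[OF assms(1)] mult_chars_nonzero[OF assms] flip: mult.assoc)
  also have "\<dots> = (\<Sum>x\<in>UNIV - {0}. \<psi> x * (inverse (\<eta> a) * \<eta> x))"
    by (rule sum_nonzero_scale[OF assms(2)])
  finally show ?thesis
    by (simp add: gauss_sum_def char_inv_def sum_distrib_left sum_negf mult_ac)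
qed

text \<open>For nontrivial \<open>\<eta>\<close> this is the classical evaluation of \<open>g(\<eta>) g(\<eta>\<inverse>)\<close>: the twist formula makes the
product a double sum over \<open>x, y\<close> of \<open>\<eta> x\<close> times \<open>\<psi> ((1 + x) y)\<close>, whose inner sum over \<open>y\<close> is \<open>-1\<close>
except that it gains \<open>q\<close> at \<open>x = -1\<close>. The factor \<open>q\<close> in
\<^const>\<open>gauss_sum_circ\<close> of the trivial character makes the formula hold there as well.
The formula also shows that no Gauss sum vanishes.\<close>

lemma gauss_sum_reflection:
  fixes \<psi> :: "'k::{field,finite} \<Rightarrow> qbar"
  assumes \<psi>: "\<psi> \<in> add_chars" "\<exists>a. \<psi> a \<noteq> 1" and \<eta>: "\<eta> \<in> mult_chars"
  shows "gauss_sum_circ \<psi> \<eta> * gauss_sum \<psi> (char_inv \<eta>) = of_nat CARD('k) * \<eta> (-1)"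
proof (cases "\<eta> = triv_char")
  case True
  have "char_inv triv_char = (triv_char :: 'k \<Rightarrow> qbar)"
    by (auto simp: char_inv_def triv_char_def)
  thus ?thesis using True gauss_sum_triv_char[OF \<psi>]
    by (simp add: gauss_sum_circ_def char_delta_def) (simp add: triv_char_def)
next
  case False
  have "gauss_sum \<psi> (char_inv \<eta>) * gauss_sum \<psi> \<eta> =
          (\<Sum>y\<in>UNIV - {0}. \<psi> y * char_inv \<eta> y * - gauss_sum \<psi> \<eta>)"
    by (simp add: gauss_sum_def sum_distrib_right sum_negf)
  also have "\<dots> = (\<Sum>y\<in>UNIV - {0}. \<Sum>x\<in>UNIV - {0}. \<psi> y * (\<psi> (y * x) * \<eta> x))"
    unfolding sum_distrib_left[symmetric]
    by (intro sum.cong refl, subst gauss_sum_twist[OF \<eta>]) (auto simp: mult_ac)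
  also have "\<dots> = (\<Sum>x\<in>UNIV - {0}. \<Sum>y\<in>UNIV - {0}. \<psi> y * (\<psi> (y * x) * \<eta> x))"
    by (rule sum.swap)
  also have "\<dots> = (\<Sum>x\<in>UNIV - {0}. \<eta> x * (\<Sum>y\<in>UNIV - {0}. \<psi> ((1 + x) * y)))"
    unfolding sum_distrib_left distrib_right add_chars_add[OF \<psi>(1)]
    by (simp add: mult_ac)
  also have "\<dots> = (\<Sum>x\<in>UNIV - {0}. (if x = -1 then of_nat CARD('k) * \<eta> x else 0) - \<eta> x)"
    by (intro sum.cong refl)
       (auto simp: sum_nontrivial_add_char_nonzero[OF \<psi>] add_eq_0_iff right_diff_distrib)
  also have "\<dots> = of_nat CARD('k) * \<eta> (-1)"
    by (simp add: sum_subtractf sum_nontrivial_mult_char[OF \<eta> False])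
  finally show ?thesis
    using False by (simp add: gauss_sum_circ_def char_delta_def mult_ac)
qed

lemma gauss_sum_circ_nonzero:
  fixes \<psi> :: "'k::{field,finite} \<Rightarrow> qbar"
  assumes "\<psi> \<in> add_chars" "\<exists>a. \<psi> a \<noteq> 1" "\<eta> \<in> mult_chars"
  shows "gauss_sum_circ \<psi> \<eta> \<noteq> 0"
  using gauss_sum_reflection[OF assms] mult_chars_nonzero[OF assms(3), of "-1"]
  by (auto simp del: of_nat_0_eq_iff)

lemma gauss_sum_nonzero:
  fixes \<psi> :: "'k::{field,finite} \<Rightarrow> qbar"
  assumes "\<psi> \<in> add_chars" "\<exists>a. \<psi> a \<noteq> 1" "\<eta> \<in> mult_chars"
  shows "gauss_sum \<psi> \<eta> \<noteq> 0"
  using gauss_sum_circ_nonzero[OF assms] by (auto simp: gauss_sum_circ_def)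

section \<open>The binomial theorem\<close>

text \<open>The finite analogue of the binomial series for \<open>(1 - z)\<close> to the power \<open>- \<alpha>\<close>. Expanding both Gauss sums
as sums over \<open>x\<close> and \<open>y\<close>, the sum over \<open>\<nu>\<close> forces \<open>y = - x z\<close> by orthogonality, and what remains is
the sum of \<open>\<psi> ((1 - z) x) \<alpha> x\<close>, a twisted Gauss sum of \<open>\<alpha>\<close>. At \<open>z = 1\<close> this sum is the sum of the
values of \<open>\<alpha>\<close>, which is \<open>0\<close> because \<open>\<alpha>\<close> is nontrivial.\<close>

lemma binomial_theorem_gauss_sums:
  fixes \<psi> :: "'k::{field,finite} \<Rightarrow> qbar"
  assumes \<psi>: "\<psi> \<in> add_chars"
    and \<alpha>: "\<alpha> \<in> mult_chars" "\<alpha> \<noteq> triv_char" and z: "z \<noteq> 0"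
  shows "(\<Sum>\<nu>\<in>mult_chars. gauss_sum \<psi> (char_mult \<alpha> \<nu>) * gauss_sum \<psi> (char_inv \<nu>) * \<nu> (- z)) =
           (1 - of_nat CARD('k)) * gauss_sum \<psi> \<alpha> * char_inv \<alpha> (1 - z)"
proof -
  define U where "U = UNIV - {0 :: 'k}"
  have "(\<Sum>\<nu>\<in>mult_chars. gauss_sum \<psi> (char_mult \<alpha> \<nu>) * gauss_sum \<psi> (char_inv \<nu>) * \<nu> (- z)) =
          (\<Sum>\<nu>\<in>mult_chars. \<Sum>x\<in>U. \<Sum>y\<in>U. \<psi> x * \<alpha> x * \<psi> y * \<nu> (- (x * z) / y))"
  proof (intro sum.cong refl)
    fix \<nu> :: "'k \<Rightarrow> qbar" assume \<nu>: "\<nu> \<in> mult_chars"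
    have split: "\<nu> (- (x * z) / y) = \<nu> x * inverse (\<nu> y) * \<nu> (- z)" for x y
    proof -
      have "- (x * z) / y = x * inverse y * - z" by (simp add: divide_inverse mult_ac)
      thus ?thesis by (simp only: mult_chars_mult[OF \<nu>] mult_chars_inverse[OF \<nu>])
    qed
    have "gauss_sum \<psi> (char_mult \<alpha> \<nu>) * gauss_sum \<psi> (char_inv \<nu>) =
            (\<Sum>x\<in>U. \<Sum>y\<in>U. \<psi> x * (\<alpha> x * \<nu> x) * (\<psi> y * inverse (\<nu> y)))"
      by (simp add: gauss_sum_def char_mult_def char_inv_def U_def sum_product)
    thus "gauss_sum \<psi> (char_mult \<alpha> \<nu>) * gauss_sum \<psi> (char_inv \<nu>) * \<nu> (- z) =
            (\<Sum>x\<in>U. \<Sum>y\<in>U. \<psi> x * \<alpha> x * \<psi> y * \<nu> (- (x * z) / y))"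
      unfolding split by (simp only: sum_distrib_right) (simp add: mult_ac)
  qed
  also have "\<dots> = (\<Sum>x\<in>U. \<Sum>y\<in>U. \<Sum>\<nu>\<in>mult_chars. \<psi> x * \<alpha> x * \<psi> y * \<nu> (- (x * z) / y))"
    by (subst sum.swap, intro sum.cong refl, rule sum.swap)
  also have "\<dots> = (\<Sum>x\<in>U. \<Sum>y\<in>U. if y = - (x * z) then \<psi> x * \<alpha> x * \<psi> y * (of_nat CARD('k) - 1) else 0)"
  proof (intro sum.cong refl)
    fix x y assume "x \<in> U" "y \<in> U"
    hence nz: "- (x * z) / y \<noteq> 0" and eq: "- (x * z) / y = 1 \<longleftrightarrow> y = - (x * z)"
      using z divide_eq_1_iff[of "- (x * z)" y] by (auto simp: U_def)
    show "(\<Sum>\<nu>\<in>mult_chars. \<psi> x * \<alpha> x * \<psi> y * \<nu> (- (x * z) / y)) =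
        (if y = - (x * z) then \<psi> x * \<alpha> x * \<psi> y * (of_nat CARD('k) - 1) else 0)"
      unfolding sum_distrib_left[symmetric] sum_over_mult_chars[OF nz] eq by simp
  qed
  also have "\<dots> = (of_nat CARD('k) - 1) * (\<Sum>x\<in>U. \<psi> ((1 - z) * x) * \<alpha> x)"
    unfolding sum_distrib_left
  proof (intro sum.cong refl)
    fix x assume "x \<in> U"
    hence "- (x * z) \<in> U" using z by (simp add: U_def)
    moreover have "\<psi> ((1 - z) * x) = \<psi> x * \<psi> (- (x * z))"
      by (simp add: algebra_simps flip: add_chars_add[OF \<psi>])
    ultimately show "(\<Sum>y\<in>U. if y = - (x * z)
        then \<psi> x * \<alpha> x * \<psi> y * (of_nat CARD('k) - 1) else 0) =
        (of_nat CARD('k) - 1) * (\<psi> ((1 - z) * x) * \<alpha> x)"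
      by (simp add: mult_ac U_def)
  qed
  also have "(\<Sum>x\<in>U. \<psi> ((1 - z) * x) * \<alpha> x) = - char_inv \<alpha> (1 - z) * gauss_sum \<psi> \<alpha>"
  proof (cases "z = 1")
    case True
    thus ?thesis using sum_nontrivial_mult_char[OF \<alpha>]
      by (simp add: U_def add_chars_0[OF \<psi>] char_inv_def mult_chars_0[OF \<alpha>(1)])
  next
    case False
    thus ?thesis unfolding U_def by (intro gauss_sum_twist \<alpha>) simp
  qed
  finally show ?thesis by (simp add: algebra_simps)
qed

section \<open>Jacobi sums in several variables\<close>

text \<open>The finite analogue of the Dirichlet integral. Group the product of the Gauss sums by the total \<open>t\<close> of
all its summation variables: up to sign, the coefficient of \<open>\<psi> t\<close> is
\<open>S t = (\<Sum>u. (\<Prod>i\<in>I. \<chi> i (u i)) * c (t - (\<Sum>i\<in>I. u i)))\<close>,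
and \<open>S 1\<close> is the Jacobi sum. Scaling the \<open>u i\<close> by \<open>t\<close> gives \<open>S t = \<theta> t * S 1\<close> for \<open>t \<noteq> 0\<close>, where \<open>\<theta>\<close> is
the product of all the characters, so everything depends on \<open>S 0\<close>. If \<open>\<theta>\<close> is nontrivial, scaling
shows \<open>S 0 = 0\<close>. If \<open>\<theta>\<close> is trivial, the sum of all \<open>S t\<close> is zero because \<open>c\<close> is nontrivial, so
\<open>S 0 = - (q - 1) * S 1\<close>; this turns the factor \<open>1\<close>, the Gauss sum of \<open>\<theta>\<close>, into \<open>q\<close>, which is its
\<^const>\<open>gauss_sum_circ\<close>.\<close>

lemma jacobi_sum_eq_gauss_sums:
  fixes \<psi> :: "'k::{field,finite} \<Rightarrow> qbar"
  assumes \<psi>: "\<psi> \<in> add_chars" "\<exists>a. \<psi> a \<noteq> 1"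
    and I: "finite I" and \<chi>: "\<And>i. i \<in> I \<Longrightarrow> \<chi> i \<in> mult_chars"
    and c: "c \<in> mult_chars" "c \<noteq> triv_char"
  shows "(-1) ^ card I * (\<Prod>i\<in>I. gauss_sum \<psi> (\<chi> i)) * gauss_sum \<psi> c =
           gauss_sum_circ \<psi> (char_mult c (char_prod I \<chi>)) *
           (\<Sum>u\<in>PiE I (\<lambda>_. UNIV - {0}). (\<Prod>i\<in>I. \<chi> i (u i)) * c (1 - (\<Sum>i\<in>I. u i)))"
proof -
  define P where "P = PiE I (\<lambda>_. UNIV - {0 :: 'k})"
  define S where "S = (\<lambda>t. \<Sum>u\<in>P. (\<Prod>i\<in>I. \<chi> i (u i)) * c (t - (\<Sum>i\<in>I. u i)))"
  define \<theta> where "\<theta> = char_mult c (char_prod I \<chi>)"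
  have \<theta>: "\<theta> \<in> mult_chars" unfolding \<theta>_def using I \<chi> c by simp
  have scale: "S (t * s) = \<theta> t * S s" if t: "t \<noteq> 0" for t s
  proof -
    \<comment> \<open>\<^const>\<open>restrict\<close> keeps the scaled tuple extensional, as membership in \<open>P\<close> requires.\<close>
    have "S (t * s) = (\<Sum>u\<in>P. (\<Prod>i\<in>I. \<chi> i (t * u i)) * c (t * s - (\<Sum>i\<in>I. t * u i)))"
      unfolding S_def
      by (rule sum.reindex_bij_witness[where i = "\<lambda>u. restrict (\<lambda>i. t * u i) I"
            and j = "\<lambda>u. restrict (\<lambda>i. u i / t) I"])
         (use t in \<open>auto simp: P_def PiE_iff extensional_def fun_eq_iff cong: prod.cong sum.cong\<close>)
    also have "\<dots> = (\<Sum>u\<in>P. \<theta> t * ((\<Prod>i\<in>I. \<chi> i (u i)) * c (s - (\<Sum>i\<in>I. u i))))"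
    proof (intro sum.cong refl)
      fix u
      have "c (t * s - (\<Sum>i\<in>I. t * u i)) = c t * c (s - (\<Sum>i\<in>I. u i))"
        by (simp add: mult_chars_mult[OF c(1), symmetric] right_diff_distrib sum_distrib_left)
      moreover have "(\<Prod>i\<in>I. \<chi> i (t * u i)) = (\<Prod>i\<in>I. \<chi> i t) * (\<Prod>i\<in>I. \<chi> i (u i))"
        by (simp add: mult_chars_mult[OF \<chi>] prod.distrib)
      ultimately show "(\<Prod>i\<in>I. \<chi> i (t * u i)) * c (t * s - (\<Sum>i\<in>I. t * u i)) =
          \<theta> t * ((\<Prod>i\<in>I. \<chi> i (u i)) * c (s - (\<Sum>i\<in>I. u i)))"
        using t by (simp add: \<theta>_def char_mult_def char_prod_def mult_ac)
    qed
    finally show ?thesis by (simp add: S_def sum_distrib_left)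
  qed
  have S: "S t = \<theta> t * S 1" if "t \<noteq> 0" for t using scale[OF that, of 1] by simp
  have sum_c: "(\<Sum>t\<in>UNIV. f t * c t) = (\<Sum>t\<in>UNIV - {0}. f t * c t)" for f
    by (rule sum.mono_neutral_right) (auto simp: mult_chars_0[OF c(1)])
  have split: "(\<Sum>t\<in>UNIV. f t * S t) = f 0 * S 0 + (\<Sum>t\<in>UNIV - {0}. f t * \<theta> t) * S 1" for f
  proof -
    have "(\<Sum>t\<in>UNIV. f t * S t) = f 0 * S 0 + (\<Sum>t\<in>UNIV - {0}. f t * S t)"
      by (rule sum.remove) auto
    also have "(\<Sum>t\<in>UNIV - {0}. f t * S t) = (\<Sum>t\<in>UNIV - {0}. f t * (\<theta> t * S 1))"
      by (intro sum.cong refl, subst S) auto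
    finally show ?thesis by (simp add: sum_distrib_right mult.assoc)
  qed
  have "(\<Sum>t\<in>UNIV. \<psi> t * S t) =
          (\<Sum>u\<in>P. \<Sum>t\<in>UNIV. (\<Prod>i\<in>I. \<chi> i (u i)) * (\<psi> t * c (t - (\<Sum>i\<in>I. u i))))"
    unfolding S_def sum_distrib_left by (subst sum.swap) (simp only: mult.left_commute)
  also have "\<dots> = (\<Sum>u\<in>P. (\<Prod>i\<in>I. \<psi> (u i) * \<chi> i (u i)) * - gauss_sum \<psi> c)"
  proof (intro sum.cong refl)
    fix u
    have "(\<Sum>t\<in>UNIV. \<psi> t * c (t - (\<Sum>i\<in>I. u i))) =
            (\<Sum>t\<in>UNIV. \<psi> (t + (\<Sum>i\<in>I. u i)) * c t)"
      using sum_translate[of "\<lambda>t. \<psi> t * c (t - (\<Sum>i\<in>I. u i))" "\<Sum>i\<in>I. u i"] by simp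
    also have "\<dots> = (\<Prod>i\<in>I. \<psi> (u i)) * - gauss_sum \<psi> c"
      by (simp add: add_chars_add[OF \<psi>(1)] add_chars_sum[OF \<psi>(1)] gauss_sum_def
            sum_distrib_left mult_ac flip: sum_c)
    finally show "(\<Sum>t\<in>UNIV. (\<Prod>i\<in>I. \<chi> i (u i)) * (\<psi> t * c (t - (\<Sum>i\<in>I. u i)))) =
        (\<Prod>i\<in>I. \<psi> (u i) * \<chi> i (u i)) * - gauss_sum \<psi> c"
      unfolding sum_distrib_left[symmetric] by (simp add: prod.distrib)
  qed
  also have "\<dots> = (\<Prod>i\<in>I. - gauss_sum \<psi> (\<chi> i)) * - gauss_sum \<psi> c"
    unfolding P_def by (simp add: gauss_sum_def prod_sum_PiE[OF I] flip: sum_distrib_right)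
  finally have total: "(-1) ^ card I * (\<Prod>i\<in>I. gauss_sum \<psi> (\<chi> i)) * gauss_sum \<psi> c =
      - (\<psi> 0 * S 0 + (\<Sum>t\<in>UNIV - {0}. \<psi> t * \<theta> t) * S 1)"
    by (simp add: split prod_uminus)
  have "- (S 0 - gauss_sum \<psi> \<theta> * S 1) = gauss_sum_circ \<psi> \<theta> * S 1"
  proof (cases "\<theta> = triv_char")
    case False
    obtain a where a: "a \<noteq> 0" "\<theta> a \<noteq> 1" using mult_chars_neq_trivE[OF \<theta> False] .
    have "S 0 = 0" using scale[OF a(1), of 0] a(2) by simp
    thus ?thesis using False by (simp add: gauss_sum_circ_def char_delta_def)
  next
    case True
    have "(\<Sum>t\<in>UNIV. 1 * S t) =
            (\<Sum>u\<in>P. (\<Prod>i\<in>I. \<chi> i (u i)) * (\<Sum>t\<in>UNIV. c (t - (\<Sum>i\<in>I. u i))))"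
      unfolding S_def sum_distrib_left by (subst sum.swap) simp
    also have "\<dots> = 0"
    proof (intro sum.neutral ballI)
      fix u
      show "(\<Prod>i\<in>I. \<chi> i (u i)) * (\<Sum>t\<in>UNIV. c (t - (\<Sum>i\<in>I. u i))) = 0"
        using sum_translate[of c "- (\<Sum>i\<in>I. u i)"] sum_c[of "\<lambda>_. 1"] sum_nontrivial_mult_char[OF c]
        by simp
    qed
    finally have "S 0 = - (\<Sum>t\<in>UNIV - {0}. \<theta> t) * S 1"
      unfolding split by (simp add: eq_neg_iff_add_eq_0)
    also have "(\<Sum>t\<in>UNIV - {0 :: 'k}. \<theta> t) = of_nat CARD('k) - 1"
      by (simp add: True triv_char_def of_nat_diff)
    finally show ?thesis
      using True gauss_sum_triv_char[OF \<psi>]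
      by (simp add: gauss_sum_circ_def char_delta_def algebra_simps)
  qed
  thus ?thesis
    using total by (simp add: add_chars_0[OF \<psi>(1)] gauss_sum_def \<theta>_def S_def P_def)
qed

section \<open>The integral representation\<close>

lemma card_field_neq_1: "CARD('k::{field,finite}) \<noteq> 1"
proof
  assume "CARD('k) = 1"
  then obtain z where "UNIV = {z :: 'k}" by (auto simp: card_1_singleton_iff)
  thus False using zero_neq_one[where 'a = 'k] by (metis UNIV_I singletonD)
qed

text \<open>By reflection, the denominators \<open>poch_circ \<psi> triv_char \<nu>\<close> of the hypergeometric series become Gauss sums
in the numerator, where they can be expanded.\<close>

lemma inverse_poch_circ_triv_char:
  fixes \<psi> :: "'k::{field,finite} \<Rightarrow> qbar"
  assumes \<psi>: "\<psi> \<in> add_chars" "\<exists>a. \<psi> a \<noteq> 1" and \<nu>: "\<nu> \<in> mult_chars"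
  shows "inverse (poch_circ \<psi> triv_char \<nu>) = gauss_sum \<psi> (char_inv \<nu>) * \<nu> (-1)"
proof -
  have "\<nu> (-1) * \<nu> (-1) = 1"
    using mult_chars_mult[OF \<nu>, of "-1" "-1"] mult_chars_1[OF \<nu>] by simp
  hence "gauss_sum_circ \<psi> \<nu> * (gauss_sum \<psi> (char_inv \<nu>) * \<nu> (-1)) = of_nat CARD('k)"
    using gauss_sum_reflection[OF assms] by (simp flip: mult.assoc)
  thus ?thesis
    using \<nu> gauss_sum_circ_nonzero[OF assms]
    by (simp add: poch_circ_def gauss_sum_circ_def[of _ triv_char] char_delta_def
          gauss_sum_triv_char[OF \<psi>] field_simps)
qed

theorem theorem3p5:
  fixes \<psi> :: "'k::{field,finite} \<Rightarrow> qbar"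
    and n :: nat
    and \<alpha> \<beta> :: "nat \<Rightarrow> 'k \<Rightarrow> qbar"
    and \<gamma> :: "'k \<Rightarrow> qbar"
    and x :: "nat \<Rightarrow> 'k"
  assumes "\<psi> \<in> add_chars" and "\<exists>a. \<psi> a \<noteq> 1"
    and "n \<ge> 1"
    and "\<forall>i\<in>{1..n}. \<alpha> i \<in> mult_chars"
    and "\<forall>i\<in>{1..n}. \<beta> i \<in> mult_chars"
    and "\<gamma> \<in> mult_chars"
    and "\<forall>i\<in>{1..n}. \<alpha> i \<noteq> triv_char"
    and "char_prod {1..n} \<beta> \<noteq> \<gamma>"
    and "\<forall>i\<in>{1..n}. x i \<noteq> 0"
  shows "(-1) ^ n *
      ((\<Prod>i=1..n. gauss_sum \<psi> (\<beta> i)) *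
        gauss_sum \<psi> (char_mult (char_inv (char_prod {1..n} \<beta>)) \<gamma>) / gauss_sum_circ \<psi> \<gamma>) *
      lauricella_FB \<psi> n \<alpha> \<beta> \<gamma> x =
    (\<Sum>u\<in>PiE {1..n} (\<lambda>_. UNIV - {0}).
      (\<Prod>i=1..n. char_inv (\<alpha> i) (1 - x i * u i)) *
      (\<Prod>i=1..n. \<beta> i (u i)) *
      char_mult (char_inv (char_prod {1..n} \<beta>)) \<gamma> (1 - (\<Sum>i=1..n. u i)))"
proof -
  define I where "I = {1..n}"
  define q :: qbar where "q = of_nat CARD('k)"
  define b where "b = char_prod I \<beta>"
  define c where "c = char_mult (char_inv b) \<gamma>"
  define U where "U = PiE I (\<lambda>_. UNIV - {0 :: 'k})"
  define M where "M = PiE I (\<lambda>_. mult_chars :: ('k \<Rightarrow> qbar) set)"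
  define G where "G = (\<Prod>i\<in>I. gauss_sum \<psi> (\<beta> i)) * gauss_sum \<psi> c / gauss_sum_circ \<psi> \<gamma>"
  define T where "T = (\<lambda>\<nu>. (\<Prod>i\<in>I. poch \<psi> (\<alpha> i) (\<nu> i)) * (\<Prod>i\<in>I. poch \<psi> (\<beta> i) (\<nu> i)) /
        (poch_circ \<psi> \<gamma> (char_prod I \<nu>) * (\<Prod>i\<in>I. poch_circ \<psi> triv_char (\<nu> i))) *
        (\<Prod>i\<in>I. \<nu> i (x i)))"
  \<comment> \<open>The contribution of the variable \<open>u i = v\<close> and the character \<open>\<nu> i = \<mu>\<close> to a term of the expansion.\<close>
  define K where "K = (\<lambda>i \<mu> v. gauss_sum \<psi> (char_mult (\<alpha> i) \<mu>) *
        gauss_sum \<psi> (char_inv \<mu>) * \<mu> (- (x i * v)) / gauss_sum \<psi> (\<alpha> i))"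
  define h where "h = (\<lambda>u. (\<Prod>i\<in>I. \<beta> i (u i)) * c (1 - (\<Sum>i\<in>I. u i)))"
  note \<psi> = assms(1,2)
  have I: "finite I" "card I = n" by (simp_all add: I_def)
  have \<alpha>: "\<alpha> i \<in> mult_chars" "\<alpha> i \<noteq> triv_char" and \<beta>: "\<beta> i \<in> mult_chars" and x: "x i \<noteq> 0"
    if "i \<in> I" for i using assms that by (auto simp: I_def)
  have b: "b \<in> mult_chars" unfolding b_def using I \<beta> by simp
  have c: "c \<in> mult_chars" unfolding c_def using b assms(6) by simp
  have bc: "b t * c t = \<gamma> t" for t
    using mult_chars_nonzero[OF b, of t] mult_chars_0[OF assms(6)] mult_chars_0[OF b]
    by (cases "t = 0") (auto simp: c_def char_mult_def char_inv_def)
  have "c \<noteq> triv_char"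
  proof
    assume "c = triv_char"
    hence "b t = \<gamma> t" for t
      using bc[of t] mult_chars_0[OF b] by (auto simp: triv_char_def split: if_splits)
    hence "b = \<gamma>" by (rule ext)
    thus False using assms(8) by (simp add: b_def I_def)
  qed
  have q: "1 - q \<noteq> 0"
    using card_field_neq_1 by (simp add: q_def)

  \<comment> \<open>After reflection, the factors depending on \<open>\<beta>\<close> and \<open>\<gamma>\<close> are exactly the Gauss sums of a Jacobi
    sum for the characters \<open>\<beta> i * \<nu> i\<close> and \<open>c\<close>, whose product is \<open>\<gamma>\<close> times all \<open>\<nu> i\<close>.\<close>
  have term_eq: "(-1) ^ n * G * T \<nu> = (\<Sum>u\<in>U. (\<Prod>i\<in>I. K i (\<nu> i) (u i)) * h u)"
    if "\<nu> \<in> M" for \<nu>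
  proof -
    have \<nu>: "\<nu> i \<in> mult_chars" if "i \<in> I" for i using \<open>\<nu> \<in> M\<close> that by (auto simp: M_def)
    define \<theta> where "\<theta> = char_mult \<gamma> (char_prod I \<nu>)"
    define A where "A = (\<lambda>i. gauss_sum \<psi> (char_mult (\<alpha> i) (\<nu> i)) *
        gauss_sum \<psi> (char_inv (\<nu> i)) * \<nu> i (- x i) / gauss_sum \<psi> (\<alpha> i))"
    have \<theta>: "\<theta> \<in> mult_chars" unfolding \<theta>_def using assms(6) I \<nu> by simp
    have "char_mult c (char_prod I (\<lambda>i. char_mult (\<beta> i) (\<nu> i))) = \<theta>"
    proof
      fix t
      show "char_mult c (char_prod I (\<lambda>i. char_mult (\<beta> i) (\<nu> i))) t = \<theta> t"
        using bc[of t]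
        by (auto simp: char_mult_def char_prod_def \<theta>_def b_def prod.distrib mult_ac)
    qed
    hence jac: "(-1) ^ n * (\<Prod>i\<in>I. gauss_sum \<psi> (char_mult (\<beta> i) (\<nu> i))) * gauss_sum \<psi> c =
        gauss_sum_circ \<psi> \<theta> *
        (\<Sum>u\<in>U. (\<Prod>i\<in>I. \<beta> i (u i) * \<nu> i (u i)) * c (1 - (\<Sum>i\<in>I. u i)))"
      using jacobi_sum_eq_gauss_sums[OF \<psi> I(1), of "\<lambda>i. char_mult (\<beta> i) (\<nu> i)" c] \<beta> \<nu> c
        \<open>c \<noteq> triv_char\<close> I(2)
      by (simp add: U_def) (simp add: char_mult_def)
    have "T \<nu> = (\<Prod>i\<in>I. poch \<psi> (\<alpha> i) (\<nu> i) * inverse (poch_circ \<psi> triv_char (\<nu> i)) * \<nu> i (x i)) *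
        (\<Prod>i\<in>I. poch \<psi> (\<beta> i) (\<nu> i)) / poch_circ \<psi> \<gamma> (char_prod I \<nu>)"
      by (simp add: T_def prod.distrib prod_inversef[symmetric, unfolded o_def] divide_inverse mult_ac)
    also have "(\<Prod>i\<in>I. poch \<psi> (\<alpha> i) (\<nu> i) * inverse (poch_circ \<psi> triv_char (\<nu> i)) * \<nu> i (x i)) =
        (\<Prod>i\<in>I. A i)"
    proof (rule prod.cong[OF refl])
      fix i assume i: "i \<in> I"
      have "\<nu> i (- x i) = \<nu> i (-1) * \<nu> i (x i)"
        by (simp flip: mult_chars_mult[OF \<nu>[OF i]])
      thus "poch \<psi> (\<alpha> i) (\<nu> i) * inverse (poch_circ \<psi> triv_char (\<nu> i)) * \<nu> i (x i) = A i"
        by (simp add: inverse_poch_circ_triv_char[OF \<psi> \<nu>[OF i]] A_def poch_def)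
    qed
    finally have T: "T \<nu> = (\<Prod>i\<in>I. A i) * (\<Prod>i\<in>I. poch \<psi> (\<beta> i) (\<nu> i)) /
        poch_circ \<psi> \<gamma> (char_prod I \<nu>)" .
    have "(\<Prod>i\<in>I. gauss_sum \<psi> (\<beta> i)) * (\<Prod>i\<in>I. poch \<psi> (\<beta> i) (\<nu> i)) =
        (\<Prod>i\<in>I. gauss_sum \<psi> (char_mult (\<beta> i) (\<nu> i)))"
      unfolding prod.distrib[symmetric]
      by (intro prod.cong refl) (simp add: poch_def gauss_sum_nonzero[OF \<psi> \<beta>])
    moreover have "(-1) ^ n * G * T \<nu> = (\<Prod>i\<in>I. A i) *
        ((-1) ^ n * ((\<Prod>i\<in>I. gauss_sum \<psi> (\<beta> i)) * (\<Prod>i\<in>I. poch \<psi> (\<beta> i) (\<nu> i))) *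
          gauss_sum \<psi> c) / gauss_sum_circ \<psi> \<theta>"
      by (simp add: T G_def poch_circ_def \<theta>_def gauss_sum_circ_nonzero[OF \<psi> assms(6)])
    ultimately have "(-1) ^ n * G * T \<nu> = (\<Prod>i\<in>I. A i) *
        (\<Sum>u\<in>U. (\<Prod>i\<in>I. \<beta> i (u i) * \<nu> i (u i)) * c (1 - (\<Sum>i\<in>I. u i)))"
      by (simp add: jac gauss_sum_circ_nonzero[OF \<psi> \<theta>])
    also have "\<dots> = (\<Sum>u\<in>U. (\<Prod>i\<in>I. A i * \<nu> i (u i)) * h u)"
      by (simp add: h_def sum_distrib_left prod.distrib mult_ac)
    also have "\<dots> = (\<Sum>u\<in>U. (\<Prod>i\<in>I. K i (\<nu> i) (u i)) * h u)"
    proof (intro sum.cong refl arg_cong2[where f = "(*)"] prod.cong)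
      fix u i assume "i \<in> I"
      have "\<nu> i (- (x i * u i)) = \<nu> i (- x i) * \<nu> i (u i)"
        by (simp flip: mult_chars_mult[OF \<nu>[OF \<open>i \<in> I\<close>]])
      thus "A i * \<nu> i (u i) = K i (\<nu> i) (u i)" by (simp add: A_def K_def)
    qed
    finally show ?thesis .
  qed

  have one_var: "(\<Sum>\<mu>\<in>mult_chars. K i \<mu> v) = (1 - q) * char_inv (\<alpha> i) (1 - x i * v)"
    if "i \<in> I" "v \<noteq> 0" for i v
    using binomial_theorem_gauss_sums[OF \<psi>(1) \<alpha>[OF that(1)], of "x i * v"] x[OF that(1)] that(2)
      gauss_sum_nonzero[OF \<psi> \<alpha>(1)[OF that(1)]]
    by (simp add: K_def q_def flip: sum_divide_distrib)

  \<comment> \<open>For fixed \<open>u\<close> the sum over the tuples \<open>\<nu>\<close> factors into one binomial sum per variable.\<close>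
  have "(-1) ^ n * G * (\<Sum>\<nu>\<in>M. T \<nu>) = (\<Sum>\<nu>\<in>M. \<Sum>u\<in>U. (\<Prod>i\<in>I. K i (\<nu> i) (u i)) * h u)"
    unfolding sum_distrib_left by (intro sum.cong refl term_eq)
  also have "\<dots> = (\<Sum>u\<in>U. (\<Sum>\<nu>\<in>M. \<Prod>i\<in>I. K i (\<nu> i) (u i)) * h u)"
    by (subst sum.swap) (simp add: sum_distrib_right)
  also have "\<dots> = (\<Sum>u\<in>U. (\<Prod>i\<in>I. \<Sum>\<mu>\<in>mult_chars. K i \<mu> (u i)) * h u)"
    unfolding M_def by (subst prod_sum_PiE[OF I(1)]) (simp_all add: finite_mult_chars)
  also have "\<dots> = (\<Sum>u\<in>U. (\<Prod>i\<in>I. (1 - q) * char_inv (\<alpha> i) (1 - x i * u i)) * h u)"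
    by (intro sum.cong refl arg_cong2[where f = "(*)"] prod.cong one_var) (auto simp: U_def)
  also have "\<dots> = (1 - q) ^ n * (\<Sum>u\<in>U. (\<Prod>i\<in>I. char_inv (\<alpha> i) (1 - x i * u i)) * h u)"
    by (simp add: prod.distrib I(2) sum_distrib_left mult.assoc)
  finally have "(-1) ^ n * G * (1 / (1 - q) ^ n * (\<Sum>\<nu>\<in>M. T \<nu>)) =
      (\<Sum>u\<in>U. (\<Prod>i\<in>I. char_inv (\<alpha> i) (1 - x i * u i)) * h u)"
    using q by (simp add: field_simps)
  thus ?thesis
    unfolding lauricella_FB_def G_def T_def M_def U_def h_def c_def b_def q_def I_def
    by (simp only: mult.assoc)
qed

end
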